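(* If $\Gamma$ is a LERF group, then all actions of $\Gamma$ on sets are LEF actions.
   Context: A group $\Gamma$ is LERF (locally extended residually finite) if every finitely generated subgroup of $\Gamma$ is an intersection of finite-index subgroups of $\Gamma$. An action $\Gamma\curvearrowright_\alpha X$ on a set is a LEF action if for all finite $F\subseteq\Gamma$ and $Z\subseteq X$ there exist a finite group $Q$, a finite set $Y$, an action $Q\curvearrowright_\beta Y$ and functions $\rho:\Gamma\to Q$, $\pi:Z\to Y$, with $\pi$ injective, such that (i) for all $g,h\in F$ with $gh\in F$, $\rho(gh)=\rho(g)\rho(h)$; (ii) if $g\in F$ and $x\in Z$ are such that $\alpha(g)\cdot x\in Z$, then $\pi(\alpha(g)\cdot x)=\beta(\rho(g))\cdot\pi(x)$. *)

theory Defs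
  imports "HOL-Algebra.Group_Action" "HOL-Algebra.Generated_Groups"
begin

definition finitely_generated_subgroup :: "'g set \<Rightarrow> ('g, 'm) monoid_scheme \<Rightarrow> bool" where
  "finitely_generated_subgroup H G \<longleftrightarrow>
     (\<exists>S. finite S \<and> S \<subseteq> carrier G \<and> H = generate G S)"

definition finite_index_subgroup :: "'g set \<Rightarrow> ('g, 'm) monoid_scheme \<Rightarrow> bool" where
  "finite_index_subgroup K G \<longleftrightarrow> subgroup K G \<and> finite (rcosets\<^bsub>G\<^esub> K)"

text \<open>The family of subgroups is required to be nonempty because an empty intersection is
  \<^term>\<open>UNIV\<close> in HOL; nothing is lost, since the whole group has finite index in itself.\<close>

definition LERF :: "('g, 'm) monoid_scheme \<Rightarrow> bool" where
  "LERF G \<longleftrightarrow>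
     (\<forall>H. finitely_generated_subgroup H G \<longrightarrow>
        (\<exists>\<K>. \<K> \<noteq> {} \<and> (\<forall>K\<in>\<K>. finite_index_subgroup K G) \<and> H = \<Inter>\<K>))"

text \<open>HOL cannot quantify over types inside a formula, so the finite group \<open>Q\<close> and the finite
  set \<open>Y\<close> are taken with elements in \<^typ>\<open>nat\<close>. Every finite group, and every action of it on a
  finite set, is isomorphic to one of this form.\<close>

definition LEF_action ::
  "('g, 'm) monoid_scheme \<Rightarrow> 'x set \<Rightarrow> ('g \<Rightarrow> 'x \<Rightarrow> 'x) \<Rightarrow> bool" where
  "LEF_action G X \<alpha> \<longleftrightarrow>
     group_action G X \<alpha> \<and>
     (\<forall>F Z. finite F \<and> F \<subseteq> carrier G \<and> finite Z \<and> Z \<subseteq> X \<longrightarrow>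
       (\<exists>(Q :: nat monoid) (Y :: nat set) \<beta> \<rho> \<pi>.
          group Q \<and> finite (carrier Q) \<and> finite Y \<and> group_action Q Y \<beta> \<and>
          \<rho> \<in> carrier G \<rightarrow> carrier Q \<and> \<pi> \<in> Z \<rightarrow> Y \<and> inj_on \<pi> Z \<and>
          (\<forall>g\<in>F. \<forall>h\<in>F. g \<otimes>\<^bsub>G\<^esub> h \<in> F \<longrightarrow> \<rho> (g \<otimes>\<^bsub>G\<^esub> h) = \<rho> g \<otimes>\<^bsub>Q\<^esub> \<rho> h) \<and>
          (\<forall>g\<in>F. \<forall>x\<in>Z. \<alpha> g x \<in> Z \<longrightarrow> \<pi> (\<alpha> g x) = \<beta> (\<rho> g) (\<pi> x))))"

end

theory Submission
  imports Defs "HOL-Algebra.Weak_Morphisms"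
begin

text \<open>
  Split \<open>Z\<close> into orbits and write its points as \<open>x = t x \<cdot> r\<close> with \<open>r\<close> the representative of the
  orbit. The elements \<open>(t (g x))\<^sup>-\<^sup>1 g (t x)\<close>, with \<open>g \<in> F\<close> and \<open>x, g x \<in> Z\<close>, generate a finitely
  generated subgroup \<open>H\<close> of the stabilizer of \<open>r\<close>, while \<open>(t x)\<^sup>-\<^sup>1 (t y)\<close> lies outside the stabilizer
  for \<open>x \<noteq> y\<close>. LERF yields a finite-index subgroup \<open>K \<supseteq> H\<close> that avoids these finitely many
  elements, and \<open>x \<mapsto> t x K\<close> embeds this part of \<open>Z\<close> into the finite \<open>\<Gamma>\<close>-set \<open>\<Gamma>/K\<close> compatibly with
  \<open>F\<close>. The disjoint union over the orbits is a finite \<open>\<Gamma>\<close>-set \<open>Y\<close>, and \<open>Q\<close> is its symmetric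
  group. In the formal proof \<open>\<Gamma>/K\<close> consists of right cosets with \<open>g \<cdot> K a = K a g\<^sup>-\<^sup>1\<close>.
\<close>

section \<open>Building group actions; models of finite ones on natural numbers\<close>

lemma group_actionI:
  fixes G (structure)
  assumes G: "group G"
    and ext: "\<And>g. g \<in> carrier G \<Longrightarrow> \<beta> g \<in> extensional Y"
    and closed: "\<And>g y. g \<in> carrier G \<Longrightarrow> y \<in> Y \<Longrightarrow> \<beta> g y \<in> Y"
    and one: "\<And>y. y \<in> Y \<Longrightarrow> \<beta> \<one> y = y"
    and mult: "\<And>g h y. g \<in> carrier G \<Longrightarrow> h \<in> carrier G \<Longrightarrow> y \<in> Y \<Longrightarrow>
                 \<beta> (g \<otimes> h) y = \<beta> g (\<beta> h y)"
  shows "group_action G Y \<beta>"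
proof -
  interpret group G by (rule G)
  \<comment> \<open>Bijectivity follows from the action laws: \<open>\<beta> (inv g)\<close> inverts
    \<open>\<beta> g\<close>.\<close>
  have bij: "\<beta> g \<in> Bij Y" if g: "g \<in> carrier G" for g
  proof -
    have "bij_betw (\<beta> g) Y Y"
    proof (rule bij_betw_byWitness[where f' = "\<beta> (inv g)"])
      show "\<forall>y\<in>Y. \<beta> (inv g) (\<beta> g y) = y" "\<forall>y\<in>Y. \<beta> g (\<beta> (inv g) y) = y"
        using g one mult[of "inv g" g] mult[of g "inv g"] by auto
    qed (use g closed in auto)
    then show ?thesis
      using ext g by (simp add: Bij_def)
  qed
  have "\<beta> (g \<otimes> h) = compose Y (\<beta> g) (\<beta> h)" if "g \<in> carrier G" "h \<in> carrier G" for g h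
    using that ext mult by (intro extensionalityI[of _ Y]) (auto simp: compose_def)
  then have "\<beta> \<in> hom G (BijGroup Y)"
    using bij by (auto simp: hom_def BijGroup_def)
  then show ?thesis
    by (simp add: group_action_def group_hom_def group_hom_axioms_def G group_BijGroup)
qed

lemma finite_carrier_BijGroup:
  assumes "finite Y"
  shows "finite (carrier (BijGroup Y))"
proof (rule finite_subset)
  show "carrier (BijGroup Y) \<subseteq> Y \<rightarrow>\<^sub>E Y"
    by (auto simp: BijGroup_def PiE_def Bij_imp_extensional dest: Bij_imp_funcset)
  show "finite (Y \<rightarrow>\<^sub>E Y)"
    using assms by (simp add: finite_PiE)
qed

lemma group_action_transport:
  assumes act: "group_action G Y \<beta>" and e: "inj_on e Y"
  shows "group_action G (e ` Y) (\<lambda>g. \<lambda>u\<in>e ` Y. e (\<beta> g (inv_into Y e u)))"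
proof -
  interpret group_action G Y \<beta> by (rule act)
  have G: "group G"
    using group_hom by (simp add: group_hom_def)
  have closed: "\<beta> g y \<in> Y" if "g \<in> carrier G" "y \<in> Y" for g y
    using element_image that by blast
  have one: "\<beta> \<one>\<^bsub>G\<^esub> y = y" if "y \<in> Y" for y
    using id_eq_one that by (metis restrict_apply')
  show ?thesis
    by (rule group_actionI[OF G])
      (auto simp: closed one e composition_rule dest!: inj_onD[OF e])
qed

text \<open>\<open>G\<close> may be infinite, so \<open>Q\<close> is not built from
  \<open>G\<close>: it is a copy, coded by numbers, of the symmetric group of the coded set
  \<open>Y'\<close>. The action homomorphism into that group becomes
  \<open>\<sigma>\<close>.\<close>

lemma finite_group_action_nat_model:
  assumes act: "group_action G Y \<beta>" and fin: "finite Y"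
  obtains Q :: "nat monoid" and Y' :: "nat set" and \<beta>' \<sigma> e
  where "group Q" "finite (carrier Q)" "finite Y'" "group_action Q Y' \<beta>'"
    "\<sigma> \<in> hom G Q" "bij_betw e Y Y'"
    "\<And>g y. g \<in> carrier G \<Longrightarrow> y \<in> Y \<Longrightarrow> e (\<beta> g y) = \<beta>' (\<sigma> g) (e y)"
proof -
  obtain e :: "_ \<Rightarrow> nat" where e: "inj_on e Y"
    using finite_imp_inj_to_nat_seg[OF fin] by blast
  define Y' where "Y' = e ` Y"
  define \<gamma> where "\<gamma> = (\<lambda>g. \<lambda>u\<in>Y'. e (\<beta> g (inv_into Y e u)))"
  let ?B = "BijGroup Y'"
  have \<gamma>: "group_action G Y' \<gamma>"
    unfolding \<gamma>_def Y'_def by (rule group_action_transport[OF act e])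
  have finY': "finite Y'"
    using fin by (simp add: Y'_def)
  interpret B: group ?B by (rule group_BijGroup)
  obtain j :: "_ \<Rightarrow> nat" where j: "inj_on j (carrier ?B)"
    using finite_imp_inj_to_nat_seg[OF finite_carrier_BijGroup[OF finY']] by blast
  define Q where "Q = image_group j ?B"
  have iso: "j \<in> iso ?B Q"
    using inj_imp_image_group_iso[OF j] by (simp add: Q_def)
  have Q: "group Q"
    using B.inj_imp_image_group_is_group[OF j] by (simp add: Q_def)
  have hom: "j \<circ> \<gamma> \<in> hom G Q"
    using \<gamma> iso by (auto simp: group_action_def group_hom_def group_hom_axioms_def iso_def
        intro: hom_compose)
  have "inv_into (carrier ?B) j \<in> hom Q ?B"
    using B.iso_set_sym[OF iso] by (simp add: iso_def)
  \<comment> \<open>\<open>Q\<close> acts tautologically: a number is decoded to the permutation it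
    stands for.\<close>
  then have actQ: "group_action Q Y' (inv_into (carrier ?B) j)"
    by (simp add: group_action_def group_hom_def group_hom_axioms_def Q group_BijGroup)
  show thesis
  proof (rule that[OF Q _ finY' actQ hom])
    show "finite (carrier Q)"
      by (simp add: Q_def image_group_carrier finite_carrier_BijGroup finY')
    show "bij_betw e Y Y'"
      using e by (simp add: Y'_def bij_betw_def)
    fix g y assume g: "g \<in> carrier G" and y: "y \<in> Y"
    have "\<gamma> g \<in> carrier ?B"
      using \<gamma> g by (auto simp: group_action_def group_hom_def group_hom_axioms_def hom_def)
    then show "e (\<beta> g y) = inv_into (carrier ?B) j ((j \<circ> \<gamma>) g) (e y)"
      using y e j by (simp add: \<gamma>_def Y'_def)
  qed
qed

section \<open>Finite-index subgroups, separation and coset actions\<close>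

context group
begin

text \<open>A coset of \<open>K \<inter> L\<close> is the intersection of a coset of
  \<open>K\<close> with one of \<open>L\<close>, and there are finitely many such pairs.\<close>

lemma finite_index_subgroup_Int:
  assumes "finite_index_subgroup K G" "finite_index_subgroup L G"
  shows "finite_index_subgroup (K \<inter> L) G"
proof -
  have KL: "subgroup K G" "subgroup L G" and fin: "finite (rcosets K)" "finite (rcosets L)"
    using assms by (auto simp: finite_index_subgroup_def)
  have sub: "subgroup (K \<inter> L) G"
    using subgroups_Inter_pair KL by blast
  have mem: "x \<in> M #> a \<longleftrightarrow> x \<in> carrier G \<and> x \<otimes> inv a \<in> M"
    if "subgroup M G" "a \<in> carrier G" for M x a
    using that subgroup.rcos_module[OF that(1) is_group that(2)]
      subgroup.elemrcos_carrier[OF that(1) is_group that(2)] by blast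
  have "(K \<inter> L) #> a = (K #> a) \<inter> (L #> a)" if "a \<in> carrier G" for a
    using that by (auto simp: mem sub KL)
  then have "rcosets (K \<inter> L) \<subseteq> (\<lambda>(A, B). A \<inter> B) ` ((rcosets K) \<times> (rcosets L))"
    by (force simp: RCOSETS_def)
  then have "finite (rcosets (K \<inter> L))"
    using fin by (meson finite_SigmaI finite_imageI finite_subset)
  then show ?thesis
    using sub by (simp add: finite_index_subgroup_def)
qed

text \<open>Each element of \<open>A\<close> is missed by some member of the family with
  intersection \<open>H\<close>; intersecting finitely many members handles all of \<open>A\<close>
  at once. For empty \<open>A\<close> any member will do.\<close>

lemma LERF_separates_finite:
  assumes "LERF G" "finitely_generated_subgroup H G" "finite A" "A \<inter> H = {}"
  shows "\<exists>K. finite_index_subgroup K G \<and> H \<subseteq> K \<and> A \<inter> K = {}"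
proof -
  obtain \<K> where \<K>: "\<K> \<noteq> {}" "\<And>K. K \<in> \<K> \<Longrightarrow> finite_index_subgroup K G" "H = \<Inter>\<K>"
    using assms(1,2) unfolding LERF_def by metis
  show ?thesis
    using assms(3,4)
  proof (induction A)
    case empty
    then show ?case using \<K> by blast
  next
    case (insert a A)
    then obtain K L where "finite_index_subgroup K G" "H \<subseteq> K" "A \<inter> K = {}" "L \<in> \<K>" "a \<notin> L"
      using \<K>(3) by auto
    then show ?case
      using finite_index_subgroup_Int[of K L] \<K> by (intro exI[of _ "K \<inter> L"]) blast
  qed
qed

text \<open>Right multiplication by \<open>inv g\<close> makes this a left action. The tag
  \<open>r\<close> keeps the coset spaces disjoint even where the subgroups coincide.\<close>

lemma rcosets_action:
  assumes K: "\<And>r. r \<in> R \<Longrightarrow> subgroup (K r) G"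
  defines "Y \<equiv> SIGMA r:R. rcosets (K r)"
  shows "group_action G Y (\<lambda>g. \<lambda>(r, C)\<in>Y. (r, C #> inv g))"
proof (rule group_actionI)
  have sub: "C \<subseteq> carrier G" if "(r, C) \<in> Y" for r C
    using that K subgroup.rcosets_carrier[OF _ is_group] by (auto simp: Y_def)
  have closed: "(r, C #> g) \<in> Y" if "(r, C) \<in> Y" "g \<in> carrier G" for r C g
    using that K[THEN subgroup.subset]
    by (auto simp: Y_def RCOSETS_def coset_mult_assoc)
  show "(\<lambda>(r, C)\<in>Y. (r, C #> inv g)) y \<in> Y" if "g \<in> carrier G" "y \<in> Y" for g y
    using that closed by (cases y) auto
  show "(\<lambda>(r, C)\<in>Y. (r, C #> inv \<one>)) y = y" if "y \<in> Y" for y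
    using that sub by (cases y) auto
  show "(\<lambda>(r, C)\<in>Y. (r, C #> inv (g \<otimes> h))) y =
      (\<lambda>(r, C)\<in>Y. (r, C #> inv g)) ((\<lambda>(r, C)\<in>Y. (r, C #> inv h)) y)"
    if "g \<in> carrier G" "h \<in> carrier G" "y \<in> Y" for g h y
    using that sub closed by (cases y) (auto simp: inv_mult_group coset_mult_assoc)
qed (simp_all add: is_group)

end

text \<open>The choice of \<open>r x\<close> depends only on the orbit as a set, so it is the same
  for all points of that orbit; symmetry of the orbit relation then provides
  \<open>t x\<close>.\<close>

lemma (in group_action) orbit_representatives:
  obtains r t where
    "\<And>x. x \<in> E \<Longrightarrow> r x \<in> E" "\<And>x. x \<in> E \<Longrightarrow> t x \<in> carrier G" "\<And>x. x \<in> E \<Longrightarrow> \<phi> (t x) (r x) = x"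
    "\<And>g x. g \<in> carrier G \<Longrightarrow> x \<in> E \<Longrightarrow> r (\<phi> g x) = r x"
proof -
  define r where "r x = (SOME y. y \<in> orbit G \<phi> x)" for x
  have r: "r x \<in> orbit G \<phi> x" if "x \<in> E" for x
    unfolding r_def using orbit_refl[OF that] by (rule someI)
  have orbE: "y \<in> E" if "x \<in> E" "y \<in> orbit G \<phi> x" for x y
    using that element_image by (auto simp: orbit_def)
  then have rE: "r x \<in> E" if "x \<in> E" for x
    using r that by blast
  have "\<exists>g\<in>carrier G. \<phi> g (r x) = x" if "x \<in> E" for x
    using orbit_sym[OF that rE[OF that] r[OF that]]
    by (simp add: orbit_def) metis
  then obtain t where t: "\<And>x. x \<in> E \<Longrightarrow> t x \<in> carrier G \<and> \<phi> (t x) (r x) = x"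
    by metis
  have "r (\<phi> g x) = r x" if g: "g \<in> carrier G" and x: "x \<in> E" for g x
  proof -
    have gx: "\<phi> g x \<in> orbit G \<phi> x"
      using g by (auto simp: orbit_def)
    have "orbit G \<phi> (\<phi> g x) = orbit G \<phi> x"
      using orbE[OF x gx] gx x orbit_sym orbit_trans orbE by (meson subsetI subset_antisym)
    then show ?thesis by (simp add: r_def)
  qed
  then show thesis
    using rE t that by blast
qed

section \<open>Embedding the finite set into a finite union of coset spaces\<close>

theorem theorem1p7:
  fixes \<Gamma> :: "('g, 'm) monoid_scheme"
    and X :: "'x set"
    and \<alpha> :: "'g \<Rightarrow> 'x \<Rightarrow> 'x"
  assumes "group \<Gamma>"
    and "LERF \<Gamma>"
    and "group_action \<Gamma> X \<alpha>"
  shows "LEF_action \<Gamma> X \<alpha>"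
  unfolding LEF_action_def
proof (intro conjI allI impI)
  show "group_action \<Gamma> X \<alpha>" by fact
  fix F Z assume "finite F \<and> F \<subseteq> carrier \<Gamma> \<and> finite Z \<and> Z \<subseteq> X"
  then have F: "finite F" "F \<subseteq> carrier \<Gamma>" and Z: "finite Z" "Z \<subseteq> X" by auto
  interpret group \<Gamma> by fact
  interpret group_action \<Gamma> X \<alpha> by fact
  obtain r t where r: "\<And>x. x \<in> X \<Longrightarrow> r x \<in> X" and t: "\<And>x. x \<in> X \<Longrightarrow> t x \<in> carrier \<Gamma>"
    and tr: "\<And>x. x \<in> X \<Longrightarrow> \<alpha> (t x) (r x) = x"
    and r_orbit: "\<And>g x. g \<in> carrier \<Gamma> \<Longrightarrow> x \<in> X \<Longrightarrow> r (\<alpha> g x) = r x"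
    using orbit_representatives by blast
  \<comment> \<open>\<open>S p\<close> is what \<open>K p\<close> must contain for
    \<open>\<pi>\<close> below to respect \<open>F\<close>; \<open>A p\<close> is what it must avoid
    for \<open>\<pi>\<close> to be injective.\<close>
  define S where "S p = (\<lambda>(g, x). inv\<^bsub>\<Gamma>\<^esub> (t (\<alpha> g x)) \<otimes>\<^bsub>\<Gamma>\<^esub> (g \<otimes>\<^bsub>\<Gamma>\<^esub> t x)) `
      {(g, x). g \<in> F \<and> x \<in> Z \<and> \<alpha> g x \<in> Z \<and> r x = p}" for p
  define A where "A p = (\<lambda>(x, y). inv\<^bsub>\<Gamma>\<^esub> (t x) \<otimes>\<^bsub>\<Gamma>\<^esub> t y) `
      {(x, y). x \<in> Z \<and> y \<in> Z \<and> x \<noteq> y \<and> r x = p \<and> r y = p}" for p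
  have "\<exists>K. finite_index_subgroup K \<Gamma> \<and> S p \<subseteq> K \<and> A p \<inter> K = {}" if p: "p \<in> r ` Z" for p
  proof -
    let ?St = "stabilizer \<Gamma> \<alpha> p"
    have pX: "p \<in> X" using p r Z by auto
    have t_inv: "\<alpha> (inv\<^bsub>\<Gamma>\<^esub> (t x)) x = r x" if "x \<in> X" for x
      using orbit_sym_aux[OF t r tr] that by blast
    have finS: "finite (S p)"
      unfolding S_def by (rule finite_imageI, rule finite_subset[of _ "F \<times> Z"]) (use F Z in auto)
    have finA: "finite (A p)"
      unfolding A_def by (rule finite_imageI, rule finite_subset[of _ "Z \<times> Z"]) (use Z in auto)
    have S_St: "S p \<subseteq> ?St"
    proof
      fix s assume "s \<in> S p"
      then obtain g x where g: "g \<in> carrier \<Gamma>" and x: "x \<in> X" "\<alpha> g x \<in> X" "r x = p"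
        and s: "s = inv\<^bsub>\<Gamma>\<^esub> (t (\<alpha> g x)) \<otimes>\<^bsub>\<Gamma>\<^esub> (g \<otimes>\<^bsub>\<Gamma>\<^esub> t x)"
        using F Z by (auto simp: S_def)
      \<comment> \<open>The point \<open>p\<close> travels to \<open>x\<close>, then to
        \<open>\<alpha> g x\<close>, then back to the representative of the same orbit, which is
        \<open>p\<close>.\<close>
      have "\<alpha> s p = \<alpha> (inv\<^bsub>\<Gamma>\<^esub> (t (\<alpha> g x))) (\<alpha> g (\<alpha> (t x) p))"
        using g x pX t by (simp add: s composition_rule)
      also have "\<dots> = p"
        using tr[OF x(1)] t_inv[OF x(2)] r_orbit[OF g x(1)] x(3) by simp
      finally show "s \<in> ?St"
        using g x t by (simp add: stabilizer_def s)
    qed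
    have A_St: "A p \<inter> ?St = {}"
    proof (intro equals0I, elim IntE)
      fix a assume "a \<in> A p" and stab: "a \<in> ?St"
      then obtain x y where x: "x \<in> X" "r x = p" and y: "y \<in> X" "r y = p" and "x \<noteq> y"
        and a: "a = inv\<^bsub>\<Gamma>\<^esub> (t x) \<otimes>\<^bsub>\<Gamma>\<^esub> t y"
        using Z by (auto simp: A_def)
      \<comment> \<open>If \<open>a\<close> fixed \<open>p\<close>, then \<open>t x\<close> and its
        product with \<open>a\<close>, which is \<open>t y\<close>, would move \<open>p\<close> to
        the same point.\<close>
      have "x = \<alpha> (t x) (\<alpha> a p)"
        using tr[OF x(1)] x(2) stab by (simp add: stabilizer_def)
      also have "\<dots> = \<alpha> (t x \<otimes>\<^bsub>\<Gamma>\<^esub> a) p"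
        using x y t pX by (simp add: composition_rule a)
      also have "t x \<otimes>\<^bsub>\<Gamma>\<^esub> a = t y"
        using x y t by (simp add: a inv_solve_left' m_assoc[symmetric])
      also have "\<alpha> (t y) p = y"
        using tr[OF y(1)] y(2) by simp
      finally show False
        using \<open>x \<noteq> y\<close> by simp
    qed
    have S_carrier: "S p \<subseteq> carrier \<Gamma>"
      using S_St stabilizer_subset by blast
    \<comment> \<open>The stabilizer need not be finitely generated, so LERF is applied to this
      subgroup of it, which still misses \<open>A p\<close>.\<close>
    have "generate \<Gamma> (S p) \<subseteq> ?St"
      by (rule generate_subgroup_incl[OF S_St stabilizer_subgroup[OF pX]])
    then have "A p \<inter> generate \<Gamma> (S p) = {}"
      using A_St by blast
    moreover have "finitely_generated_subgroup (generate \<Gamma> (S p)) \<Gamma>"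
      using finS S_carrier by (auto simp: finitely_generated_subgroup_def)
    ultimately obtain K where "finite_index_subgroup K \<Gamma>" "generate \<Gamma> (S p) \<subseteq> K" "A p \<inter> K = {}"
      using LERF_separates_finite[OF \<open>LERF \<Gamma>\<close> _ finA] by blast
    moreover have "S p \<subseteq> generate \<Gamma> (S p)"
      by (auto intro: generate.incl)
    ultimately show ?thesis
      by blast
  qed
  then obtain K where Kfin: "\<And>p. p \<in> r ` Z \<Longrightarrow> finite_index_subgroup (K p) \<Gamma>"
    and SK: "\<And>p. p \<in> r ` Z \<Longrightarrow> S p \<subseteq> K p" and AK: "\<And>p. p \<in> r ` Z \<Longrightarrow> A p \<inter> K p = {}"
    by metis
  have K: "subgroup (K p) \<Gamma>" if "p \<in> r ` Z" for p
    using Kfin that by (simp add: finite_index_subgroup_def)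
  have K_eqI: "K p #>\<^bsub>\<Gamma>\<^esub> a = K p #>\<^bsub>\<Gamma>\<^esub> b" if "p \<in> r ` Z" "a \<in> carrier \<Gamma>" "b \<in> carrier \<Gamma>"
    "a \<otimes>\<^bsub>\<Gamma>\<^esub> inv\<^bsub>\<Gamma>\<^esub> b \<in> K p" for p a b
    using that coset_mult_inv1[OF coset_join2] K subgroup.subset[OF K] by simp
  have K_eqD: "a \<otimes>\<^bsub>\<Gamma>\<^esub> inv\<^bsub>\<Gamma>\<^esub> b \<in> K p" if "p \<in> r ` Z" "a \<in> carrier \<Gamma>" "b \<in> carrier \<Gamma>"
    "K p #>\<^bsub>\<Gamma>\<^esub> a = K p #>\<^bsub>\<Gamma>\<^esub> b" for p a b
    using that coset_join1[OF coset_mult_inv2] K subgroup.subset[OF K] by simp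
  define Y where "Y = (SIGMA p:r ` Z. rcosets\<^bsub>\<Gamma>\<^esub> (K p))"
  define \<beta> where "\<beta> = (\<lambda>g. \<lambda>(p, C)\<in>Y. (p, C #>\<^bsub>\<Gamma>\<^esub> inv\<^bsub>\<Gamma>\<^esub> g))"
  have act: "group_action \<Gamma> Y \<beta>"
    unfolding Y_def \<beta>_def by (rule rcosets_action[OF K])
  have finY: "finite Y"
    using Kfin Z by (auto simp: Y_def finite_index_subgroup_def)
  \<comment> \<open>Inversion turns the left coset of \<open>t x\<close> into this right coset. The
    first component separates different orbits.\<close>
  define \<pi> where "\<pi> x = (r x, K (r x) #>\<^bsub>\<Gamma>\<^esub> inv\<^bsub>\<Gamma>\<^esub> (t x))" for x
  have \<pi>Y: "\<pi> x \<in> Y" if "x \<in> Z" for x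
    using that Z t subgroup.subset[OF K] by (auto simp: \<pi>_def Y_def intro!: rcosetsI)
  have \<pi>_inj: "inj_on \<pi> Z"
  proof (rule inj_onI, rule ccontr)
    \<comment> \<open>Equal first components put the pair into the index set of
      \<open>A (r x)\<close>; equal cosets put the same element into \<open>K (r x)\<close>.\<close>
    fix x y assume xy: "x \<in> Z" "y \<in> Z" "\<pi> x = \<pi> y" "x \<noteq> y"
    then have carr: "t x \<in> carrier \<Gamma>" "t y \<in> carrier \<Gamma>"
      using t Z by auto
    have "K (r x) #>\<^bsub>\<Gamma>\<^esub> inv\<^bsub>\<Gamma>\<^esub> (t x) = K (r x) #>\<^bsub>\<Gamma>\<^esub> inv\<^bsub>\<Gamma>\<^esub> (t y)"
      using xy(3) unfolding \<pi>_def by (metis prod.inject)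
    from K_eqD[OF imageI[OF xy(1)] _ _ this]
    have "inv\<^bsub>\<Gamma>\<^esub> (t x) \<otimes>\<^bsub>\<Gamma>\<^esub> t y \<in> K (r x)"
      using carr by simp
    moreover have "inv\<^bsub>\<Gamma>\<^esub> (t x) \<otimes>\<^bsub>\<Gamma>\<^esub> t y \<in> A (r x)"
      using xy by (auto simp: A_def \<pi>_def)
    ultimately show False
      using AK xy by blast
  qed
  have \<pi>_equiv: "\<pi> (\<alpha> g x) = \<beta> g (\<pi> x)" if g: "g \<in> F" and x: "x \<in> Z" "\<alpha> g x \<in> Z" for g x
  proof -
    have carr: "g \<in> carrier \<Gamma>" "t x \<in> carrier \<Gamma>" "t (\<alpha> g x) \<in> carrier \<Gamma>"
      using g x F Z t by auto
    \<comment> \<open>By \<open>K_eqI\<close>, this membership is the equality of the cosets of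
      \<open>inv (t (\<alpha> g x))\<close> and \<open>inv (g \<otimes> t x)\<close>.\<close>
    have "inv\<^bsub>\<Gamma>\<^esub> (t (\<alpha> g x)) \<otimes>\<^bsub>\<Gamma>\<^esub> (g \<otimes>\<^bsub>\<Gamma>\<^esub> t x) \<in> K (r x)"
      using g x SK[of "r x"] by (force simp: S_def)
    then have "K (r x) #>\<^bsub>\<Gamma>\<^esub> inv\<^bsub>\<Gamma>\<^esub> (t (\<alpha> g x)) = K (r x) #>\<^bsub>\<Gamma>\<^esub> (inv\<^bsub>\<Gamma>\<^esub> (t x) \<otimes>\<^bsub>\<Gamma>\<^esub> inv\<^bsub>\<Gamma>\<^esub> g)"
      using x carr by (intro K_eqI) (auto simp: inv_mult_group)
    also have "\<dots> = K (r x) #>\<^bsub>\<Gamma>\<^esub> inv\<^bsub>\<Gamma>\<^esub> (t x) #>\<^bsub>\<Gamma>\<^esub> inv\<^bsub>\<Gamma>\<^esub> g"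
      using x carr by (simp add: coset_mult_assoc subgroup.subset[OF K])
    finally show ?thesis
      using \<pi>Y[OF x(1)] r_orbit[OF carr(1), of x] x Z by (auto simp: \<pi>_def \<beta>_def)
  qed
  obtain Q :: "nat monoid" and Y' :: "nat set" and \<beta>' \<sigma> e
    where Q: "group Q" "finite (carrier Q)" "finite Y'" "group_action Q Y' \<beta>'"
      and \<sigma>: "\<sigma> \<in> hom \<Gamma> Q" and e: "bij_betw e Y Y'"
      and equiv: "\<And>g y. g \<in> carrier \<Gamma> \<Longrightarrow> y \<in> Y \<Longrightarrow> e (\<beta> g y) = \<beta>' (\<sigma> g) (e y)"
    using finite_group_action_nat_model[OF act finY] by metis
  show "\<exists>(Q :: nat monoid) (Y :: nat set) \<beta> \<rho> \<pi>.
          group Q \<and> finite (carrier Q) \<and> finite Y \<and> group_action Q Y \<beta> \<and>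
          \<rho> \<in> carrier \<Gamma> \<rightarrow> carrier Q \<and> \<pi> \<in> Z \<rightarrow> Y \<and> inj_on \<pi> Z \<and>
          (\<forall>g\<in>F. \<forall>h\<in>F. g \<otimes>\<^bsub>\<Gamma>\<^esub> h \<in> F \<longrightarrow> \<rho> (g \<otimes>\<^bsub>\<Gamma>\<^esub> h) = \<rho> g \<otimes>\<^bsub>Q\<^esub> \<rho> h) \<and>
          (\<forall>g\<in>F. \<forall>x\<in>Z. \<alpha> g x \<in> Z \<longrightarrow> \<pi> (\<alpha> g x) = \<beta> (\<rho> g) (\<pi> x))"
  \<comment> \<open>The witnesses are \<open>\<sigma>\<close>, multiplicative on all of
    \<open>\<Gamma>\<close> and not just on \<open>F\<close>, and \<open>\<pi>\<close> followed by
    the coding \<open>e\<close>.\<close>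
  proof (intro exI conjI)
    show "\<sigma> \<in> carrier \<Gamma> \<rightarrow> carrier Q"
      using \<sigma> by (simp add: hom_def)
    show "e \<circ> \<pi> \<in> Z \<rightarrow> Y'"
      using e \<pi>Y by (auto simp: bij_betw_def)
    show "inj_on (e \<circ> \<pi>) Z"
      using \<pi>_inj e \<pi>Y by (intro comp_inj_on) (auto simp: bij_betw_def intro: inj_on_subset)
    show "\<forall>g\<in>F. \<forall>h\<in>F. g \<otimes>\<^bsub>\<Gamma>\<^esub> h \<in> F \<longrightarrow> \<sigma> (g \<otimes>\<^bsub>\<Gamma>\<^esub> h) = \<sigma> g \<otimes>\<^bsub>Q\<^esub> \<sigma> h"
      using \<sigma> F by (blast intro: hom_mult)
    show "\<forall>g\<in>F. \<forall>x\<in>Z. \<alpha> g x \<in> Z \<longrightarrow> (e \<circ> \<pi>) (\<alpha> g x) = \<beta>' (\<sigma> g) ((e \<circ> \<pi>) x)"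
      using \<pi>_equiv equiv \<pi>Y F by (simp add: subset_iff del: split_paired_All)
  qed (use Q in simp_all)
qed

end
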